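(* Let $G\colon\mathbb{R}^n\times\mathbb{R}^n\times[0,\infty)\to[0,\infty)$ be a generalized Young function satisfying (H1), (H2) and (H3) (as defined in the context), let $\overline{G}(x,t)=G(x,x,t)$, and let $$H_0(x,t)=\int_0^1\int_{\mathbb{S}^{n-1}}G(x,x,t|w_n|r)\,dS_w\,\frac{dr}{r},\qquad (x,t)\in\mathbb{R}^n\times[0,\infty).$$ Then $H_0$ is a generalized Young function (on $\mathbb{R}^n\times[0,\infty)$). Furthermore, there exist positive constants $c_1$ and $c_2$ such that $$c_1\,\overline{G}(x,t)\le H_0(x,t)\le c_2\,\overline{G}(x,t)$$ for any $(x,t)\in\mathbb{R}^n\times[0,+\infty)$.
   Context: Let $n\ge 1$ be an integer. A generalized Young function is a function $G\colon\mathbb{R}^n\times\mathbb{R}^n\times[0,\infty)\to[0,\infty)$ of the form $G(x,y,t)=\int_0^t g(x,y,\tau)\,d\tau$, where $g\colon\mathbb{R}^n\times\mathbb{R}^n\times[0,\infty)\to[0,\infty)$ satisfies, for every $(x,y)$: (i) $g(x,y,0)=0$ and $g(x,y,t)>0$ for $t>0$; (ii) $t\mapsto g(x,y,t)$ is nondecreasing on $[0,\infty)$; (iii) $t\mapsto g(x,y,t)$ is right continuous on $[0,\infty)$ and $\lim_{t\to\infty}g(x,y,t)=\infty$. Likewise, a function $H\colon\mathbb{R}^n\times[0,\infty)\to[0,\infty)$ is a generalized Young function if $H(x,t)=\int_0^t h(x,\tau)\,d\tau$ with $h\colon\mathbb{R}^n\times[0,\infty)\to[0,\infty)$ satisfying,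 for every $x$: $h(x,0)=0$ and $h(x,t)>0$ for $t>0$; $t\mapsto h(x,t)$ is nondecreasing and right continuous on $[0,\infty)$; and $\lim_{t\to\infty}h(x,t)=\infty$. Hypotheses: (H1) there exist constants $0<C_1\le C_2<\infty$ such that $C_1\le G(x,y,1)\le C_2$ for all $x,y\in\mathbb{R}^n$; (H2) for every $x\in\mathbb{R}^n$ and $t\ge0$, the map $y\mapsto G(x,y,t)$ is continuous on $\mathbb{R}^n$; (H3) there exist constants $1<p^-\le p^+<\infty$ such that $p^-\le \frac{t\,g(x,y,t)}{G(x,y,t)}\le p^+$ for all $x,y\in\mathbb{R}^n$ and $t>0$. $\mathbb{S}^{n-1}$ is the unit sphere of $\mathbb{R}^n$, $dS$ is its $(n-1)$-dimensional Hausdorff (surface) measure, and $w_n$ is the $n$-th coordinate of $w\in\mathbb{S}^{n-1}$. *)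

theory Defs
  imports "HOL-Analysis.Analysis"
begin

section \<open>Hausdorff measure\<close>

text \<open>The summand of the covering sums, \<open>(diam C)\<^sup>s\<close> with the convention that it is \<open>0\<close> for the
  empty set even if \<open>s = 0\<close>; for \<open>s = 0\<close> a nonempty set contributes \<open>1\<close>, so that the
  zero-dimensional Hausdorff measure is the counting measure.\<close>

definition diam_pow :: "nat \<Rightarrow> 'a::metric_space set \<Rightarrow> real" where
  "diam_pow s C = (if C = {} then 0 else diameter C ^ s)"

text \<open>Boundedness of the covering sets is required because \<^const>\<open>diameter\<close> is unspecified on
  unbounded sets.\<close>

definition hausdorff_content :: "nat \<Rightarrow> real \<Rightarrow> 'a::metric_space set \<Rightarrow> ennreal" where
  "hausdorff_content s \<delta> A =
     (INF C \<in> {C :: nat \<Rightarrow> 'a set. A \<subseteq> (\<Union>i. C i) \<and> (\<forall>i. bounded (C i) \<and> diameter (C i) \<le> \<delta>)}.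
        \<Sum>i. ennreal (unit_ball_vol (real s) / 2 ^ s * diam_pow s (C i)))"

definition hausdorff_outer :: "nat \<Rightarrow> 'a::metric_space set \<Rightarrow> ennreal" where
  "hausdorff_outer s A = (SUP \<delta> \<in> {0<..}. hausdorff_content s \<delta> A)"

text \<open>The outer measure is countably additive on Borel sets by Caratheodory's criterion for metric
  outer measures, so \<^const>\<open>measure_of\<close> does not degenerate to the null measure here. With the
  normalisation by the volume of the ball of diameter \<open>1\<close>, for \<open>s = n - 1\<close> this is the usual
  surface measure on hypersurfaces in an \<open>n\<close>-dimensional Euclidean space.\<close>

definition hausdorff_measure :: "nat \<Rightarrow> 'a::metric_space measure" where
  "hausdorff_measure s = measure_of UNIV (sets borel) (hausdorff_outer s)"

definition sphere_measure :: "(real^'n) measure" where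
  "sphere_measure = restrict_space (hausdorff_measure (CARD('n) - 1)) (sphere 0 1)"


section \<open>Generalized Young functions\<close>

text \<open>Functions on \<open>[0,\<infinity>)\<close> are represented by functions on all reals, whose values at negative
  arguments are irrelevant. Nonnegativity follows from the first two conditions.\<close>

definition young_density :: "(real \<Rightarrow> real) \<Rightarrow> bool" where
  "young_density \<phi> \<longleftrightarrow>
     \<phi> 0 = 0 \<and> (\<forall>t>0. \<phi> t > 0) \<and>
     mono_on {0..} \<phi> \<and>
     (\<forall>t\<ge>0. (\<phi> \<longlongrightarrow> \<phi> t) (at_right t)) \<and>
     filterlim \<phi> at_top at_top"

text \<open>A density is monotone, hence integrable over \<open>[0,t]\<close>, so the Bochner integral below is the
  genuine one.\<close>

definition young_with_density :: "(real \<Rightarrow> real) \<Rightarrow> (real \<Rightarrow> real) \<Rightarrow> bool" where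
  "young_with_density \<phi> \<Phi> \<longleftrightarrow>
     young_density \<phi> \<and> (\<forall>t\<ge>0. \<Phi> t = (LBINT \<tau>:{0..t}. \<phi> \<tau>))"

text \<open>The two-point version keeps the density \<open>g\<close> as an argument, because \<open>(H3)\<close> refers to it. It
  is determined by \<open>G\<close> on \<open>[0,\<infinity>)\<close>, being right continuous.\<close>

definition gen_young2 ::
  "('a \<Rightarrow> 'a \<Rightarrow> real \<Rightarrow> real) \<Rightarrow> ('a \<Rightarrow> 'a \<Rightarrow> real \<Rightarrow> real) \<Rightarrow> bool" where
  "gen_young2 g G \<longleftrightarrow> (\<forall>x y. young_with_density (g x y) (G x y))"

definition gen_young1 :: "('a \<Rightarrow> real \<Rightarrow> real) \<Rightarrow> bool" where
  "gen_young1 H \<longleftrightarrow> (\<exists>h. \<forall>x. young_with_density (h x) (H x))"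

definition cond_H1 :: "('a \<Rightarrow> 'a \<Rightarrow> real \<Rightarrow> real) \<Rightarrow> bool" where
  "cond_H1 G \<longleftrightarrow> (\<exists>C1 C2. 0 < C1 \<and> C1 \<le> C2 \<and> (\<forall>x y. C1 \<le> G x y 1 \<and> G x y 1 \<le> C2))"

definition cond_H2 :: "('a::topological_space \<Rightarrow> 'a \<Rightarrow> real \<Rightarrow> real) \<Rightarrow> bool" where
  "cond_H2 G \<longleftrightarrow> (\<forall>x. \<forall>t\<ge>0. continuous_on UNIV (\<lambda>y. G x y t))"

definition cond_H3 ::
  "('a \<Rightarrow> 'a \<Rightarrow> real \<Rightarrow> real) \<Rightarrow> ('a \<Rightarrow> 'a \<Rightarrow> real \<Rightarrow> real) \<Rightarrow> bool" where
  "cond_H3 g G \<longleftrightarrow>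
     (\<exists>pm pp. 1 < pm \<and> pm \<le> pp \<and>
        (\<forall>x y. \<forall>t>0. pm \<le> t * g x y t / G x y t \<and> t * g x y t / G x y t \<le> pp))"

definition diag :: "('a \<Rightarrow> 'a \<Rightarrow> real \<Rightarrow> real) \<Rightarrow> 'a \<Rightarrow> real \<Rightarrow> real" where
  "diag G x t = G x x t"

text \<open>The integrand of \<open>H\<^sub>0\<close> is nonnegative, so the double integral is taken in \<open>[0,\<infinity>]\<close>; its
  finiteness has to be proved. The index type of \<open>real^'n\<close> carries no order, hence the
  index \<open>k\<close> of the distinguished (in \<open>\<real>\<^sup>n\<close>: the last) coordinate is a parameter.\<close>

definition H0_ext ::
  "'n \<Rightarrow> (real^'n \<Rightarrow> real^'n \<Rightarrow> real \<Rightarrow> real) \<Rightarrow> real^'n \<Rightarrow> real \<Rightarrow> ennreal" where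
  "H0_ext k G x t =
     (\<integral>\<^sup>+ r\<in>{0<..<1}.
        (\<integral>\<^sup>+ w. ennreal (G x x (t * \<bar>w $ k\<bar> * r)) \<partial>sphere_measure) * ennreal (1 / r) \<partial>lborel)"

definition H0 ::
  "'n \<Rightarrow> (real^'n \<Rightarrow> real^'n \<Rightarrow> real \<Rightarrow> real) \<Rightarrow> real^'n \<Rightarrow> real \<Rightarrow> real" where
  "H0 k G x t = enn2real (H0_ext k G x t)"

end

theory Submission
  imports Defs
begin

text \<open>
  For fixed \<open>x\<close> write \<open>\<Phi> t = G x x t\<close>, with density \<open>\<phi>\<close>, and let
  \<open>F u\<close> be the integral of \<open>\<Phi> (u * \<bar>w\<^sub>k\<bar>)\<close> over the unit sphere. The substitution
  \<open>\<tau> = t * r\<close> in the outer integral shows that \<open>H\<^sub>0\<close> is the primitive of \<open>h \<tau> = F \<tau> / \<tau>\<close>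
  (\<open>nn_integral_avg\<close>). Since
  \<open>\<Phi> t / t\<close> is nondecreasing, so is \<open>h\<close>, and its remaining properties as a density follow from
  crude bounds of \<open>F\<close> by \<open>\<Phi>\<close> (\<open>young_density_avg_density\<close>).

  Monotonicity of \<open>h\<close> yields \<open>F (t / 2) = t / 2 * h (t / 2) \<le> H\<^sub>0 t \<le> t * h t = F t\<close>. On the right,
  \<open>\<bar>w\<^sub>k\<bar> \<le> 1\<close> gives \<open>F t \<le> \<sigma>(S) * \<Phi> t\<close>, where \<open>\<sigma>\<close> is the surface measure and \<open>S\<close> the sphere.
  On the left, \<open>F (t / 2) \<ge> \<sigma>(A) * \<Phi> (t / 4)\<close> with
  the caps \<open>A = {w \<in> S. 1 / 2 \<le> \<bar>w\<^sub>k\<bar>}\<close>, and the upper growth exponent of \<open>G\<close> bounds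
  \<open>\<Phi> (t / 4)\<close> below by a multiple of \<open>\<Phi> t\<close> that is the same for all \<open>x\<close> (\<open>young_quarter_ge\<close>).

  It remains to see that \<open>\<sigma>\<close> is a measure with \<open>\<sigma>(S) < \<infinity>\<close> and \<open>\<sigma>(A) > 0\<close>. Borel sets are
  measurable for the Hausdorff outer measure by Caratheodory's criterion for metric outer measures
  (\<open>metric_outer_measure_borel\<close>). Finiteness comes from an explicit cover by small cells
  (\<open>sphere_hausdorff_outer_finite\<close>), positivity from comparing a cover of the caps with the Lebesgue
  measure of its shadow in a hyperplane (\<open>sphere_caps_hausdorff_outer_pos\<close>).
\<close>

section \<open>Hausdorff outer measure on Borel sets\<close>

text \<open>Caratheodory's criterion. A closed set \<open>F\<close> has positive distance from the part
  \<open>E n\<close> of a test set \<open>T\<close> at distance at least \<open>1/(n + 1)\<close> from \<open>F\<close>, so the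
  hypothesis splits \<open>T \<inter> F\<close> from \<open>E n\<close>. What is missing from \<open>T - F\<close> is the union of the shells
  \<open>R k\<close> with \<open>k \<ge> n\<close>; shells whose indices differ by two or more are again separated, so the
  values on the even shells, and those on the odd ones, add up to at most \<open>f T\<close>. Hence the series
  over all shells converges and its tail, the error made by \<open>E n\<close>, vanishes in the limit.\<close>

lemma metric_outer_measure_closed_in_lambda_system:
  fixes f :: "'a::metric_space set \<Rightarrow> ennreal"
  assumes oms: "outer_measure_space UNIV f"
    and metric: "\<And>A B d. 0 < d \<Longrightarrow> (\<And>x y. x \<in> A \<Longrightarrow> y \<in> B \<Longrightarrow> d \<le> dist x y) \<Longrightarrow>
                   f A + f B \<le> f (A \<union> B)"
    and "closed F"
  shows "F \<in> lambda_system UNIV UNIV f"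
proof -
  interpret all: sigma_algebra UNIV "UNIV :: 'a set set"
    using sigma_algebra_Pow[of "UNIV :: 'a set"] by simp
  have mono: "f A \<le> f B" if "A \<subseteq> B" for A B
    using oms that by (auto simp: outer_measure_space_def increasing_def)
  have empty: "f {} = 0"
    using oms by (auto simp: outer_measure_space_def positive_def)
  have csub: "f (\<Union>i. A i) \<le> (\<Sum>i. f (A i))" if "disjoint_family A" for A :: "nat \<Rightarrow> 'a set"
    using oms that by (auto simp: outer_measure_space_def countably_subadditive_def)
  have sub: "f (A \<union> B) \<le> f A + f B" for A B
  proof -
    have "subadditive UNIV f"
      using all.countably_subadditive_subadditive oms by (simp add: outer_measure_space_def)
    then have "f (A \<union> (B - A)) \<le> f A + f (B - A)"
      by (metis Diff_disjoint UNIV_I subadditiveD)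
    also have "\<dots> \<le> f A + f B"
      by (intro add_left_mono mono) auto
    finally show ?thesis by simp
  qed
  have main: "f (T \<inter> F) + f (T - F) \<le> f T" if ne: "F \<noteq> {}" and fin: "f T < \<infinity>" for T
  proof -
    define d where "d x = infdist x F" for x
    define r where "r n = 1 / real (Suc n)" for n
    have dd: "d x - d y \<le> dist x y" for x y
      unfolding d_def using infdist_triangle[of x F y] by linarith
    have dpos: "0 < d x" if "x \<notin> F" for x
      unfolding d_def using infdist_pos_not_in_closed[OF \<open>closed F\<close> ne that] .
    have r0: "0 < r n" for n by (simp add: r_def)
    have rless: "r n < r m" if "m < n" for m n
      using that by (simp add: r_def field_simps)
    have rle: "r n \<le> r m" if "m \<le> n" for m n
      using that by (simp add: r_def field_simps)
    define E where "E n = {x \<in> T. r n \<le> d x}" for n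
    define R where "R n = {x \<in> T. r (Suc n) \<le> d x \<and> d x < r n}" for n
    \<comment> \<open>The shell of index \<open>2 * m + j\<close> lies closer to \<open>F\<close> than \<open>r (2 * m + j)\<close>, the
    previous ones of the same parity stay at distance at least \<open>r (2 * m + j - 1)\<close>.\<close>
    have alternate: "(\<Sum>i<m. f (R (2 * i + j))) \<le> f (\<Union>i<m. R (2 * i + j))" for m j
    proof (induction m)
      case (Suc m)
      let ?U = "\<Union>i<m. R (2 * i + j)"
      have "f ?U + f (R (2 * m + j)) \<le> f (?U \<union> R (2 * m + j))"
      proof (cases "m = 0")
        case False
        show ?thesis
        proof (rule metric[of "r (2 * m + j - 1) - r (2 * m + j)"])
          show "0 < r (2 * m + j - 1) - r (2 * m + j)" using rless False by auto
          fix x y assume x: "x \<in> ?U" and y: "y \<in> R (2 * m + j)"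
          from x obtain i where i: "i < m" "x \<in> R (2 * i + j)" by auto
          have "r (2 * m + j - 1) \<le> r (Suc (2 * i + j))"
            using i(1) by (intro rle) linarith
          also have "\<dots> \<le> d x" using i by (auto simp: R_def)
          finally show "r (2 * m + j - 1) - r (2 * m + j) \<le> dist x y"
            using dd[of x y] y by (auto simp: R_def)
        qed
      qed (simp add: empty)
      moreover have "?U \<union> R (2 * m + j) = (\<Union>i<Suc m. R (2 * i + j))"
        by (auto simp: less_Suc_eq)
      ultimately show ?case
        using order_trans[OF add_right_mono[OF Suc.IH]] by simp
    qed (simp add: empty)
    have half: "(\<Sum>i. f (R (2 * i + j))) \<le> f T" for j
    proof (rule suminf_le_const)
      fix m
      have "f (\<Union>i<m. R (2 * i + j)) \<le> f T"
        by (rule mono) (auto simp: R_def)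
      then show "(\<Sum>i<m. f (R (2 * i + j))) \<le> f T"
        using alternate order_trans by blast
    qed auto
    have total: "(\<Sum>n. f (R n)) \<le> f T + f T"
    proof (rule suminf_le_const)
      fix m
      have "(\<Sum>n<m. f (R n)) \<le> (\<Sum>n<2*m. f (R n))"
        by (rule sum_mono2) auto
      also have "\<dots> = (\<Sum>i<m. f (R (2 * i + 0))) + (\<Sum>i<m. f (R (2 * i + 1)))"
        by (induction m) (auto simp: algebra_simps)
      also have "\<dots> \<le> (\<Sum>i. f (R (2 * i + 0))) + (\<Sum>i. f (R (2 * i + 1)))"
        by (intro add_mono sum_le_suminf) auto
      also have "\<dots> \<le> f T + f T" by (intro add_mono half)
      finally show "(\<Sum>n<m. f (R n)) \<le> f T + f T" .
    qed auto
    have "(\<Sum>n. f (R n)) < \<infinity>"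
      using total fin by (auto simp: le_less_trans)
    define a where "a n = enn2real (f (R n))" for n
    have fa: "f (R n) = ennreal (a n)" for n
    proof -
      have "f (R n) \<le> f T" by (rule mono) (auto simp: R_def)
      then show ?thesis using fin by (simp add: a_def le_less_trans)
    qed
    have a0: "0 \<le> a n" for n by (simp add: a_def)
    have summ: "summable a"
      using \<open>(\<Sum>n. f (R n)) < \<infinity>\<close> a0 by (simp add: fa summable_suminf_not_top)
    have T_split: "f (T - F) \<le> f (E n) + ennreal (\<Sum>k. a (k + n))" for n
    proof -
      have "T - F \<subseteq> E n \<union> (\<Union>k. R (k + n))"
      proof
        fix x assume x: "x \<in> T - F"
        obtain m where m: "r m < d x"
          using reals_Archimedean[OF dpos[of x]] x by (auto simp: r_def inverse_eq_divide)
        show "x \<in> E n \<union> (\<Union>k. R (k + n))"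
        proof (cases "r n \<le> d x")
          case False
          \<comment> \<open>The first scale that separates \<open>x\<close> from \<open>F\<close> determines the shell of \<open>x\<close>.\<close>
          define l where "l = (LEAST l. r l \<le> d x)"
          have l: "r l \<le> d x" unfolding l_def by (rule LeastI[of _ m]) (use m in simp)
          have "n < l"
            using l False rless by (metis leD le_less_linear le_less_trans less_eq_real_def not_less_iff_gr_or_eq)
          have "\<not> r (l - 1) \<le> d x"
            unfolding l_def by (rule not_less_Least) (use \<open>n < l\<close> in \<open>simp add: l_def\<close>)
          then have "x \<in> R (l - 1 - n + n)"
            using x l \<open>n < l\<close> by (simp add: R_def)
          then show ?thesis by blast
        qed (use x in \<open>auto simp: E_def\<close>)
      qed
      then have "f (T - F) \<le> f (E n) + f (\<Union>k. R (k + n))"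
        using mono sub order_trans by blast
      also have "f (\<Union>k. R (k + n)) \<le> (\<Sum>k. f (R (k + n)))"
      proof (rule csub, unfold disjoint_family_on_def, intro ballI impI)
        have aux: "R p \<inter> R q = {}" if "p < q" for p q
          using that rless[of "Suc p" q] by (cases "Suc p = q") (auto simp: R_def)
        fix p q :: nat assume "p \<noteq> q"
        then show "R (p + n) \<inter> R (q + n) = {}"
          using aux[of "p + n" "q + n"] aux[of "q + n" "p + n"] by (cases p q rule: linorder_cases) auto
      qed
      also have "(\<Sum>k. f (R (k + n))) = ennreal (\<Sum>k. a (k + n))"
        unfolding fa using summ a0 by (intro suminf_ennreal2) (auto simp: summable_iff_shift)
      finally show ?thesis by (simp add: add_left_mono)
    qed
    have E: "f (T \<inter> F) + f (E n) \<le> f T" for n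
    proof -
      have "f (T \<inter> F) + f (E n) \<le> f ((T \<inter> F) \<union> E n)"
      proof (rule metric[OF r0[of n]])
        fix x y assume "x \<in> T \<inter> F" "y \<in> E n"
        then show "r n \<le> dist x y"
          using dd[of y x] by (auto simp: E_def d_def dist_commute)
      qed
      also have "\<dots> \<le> f T" by (rule mono) (auto simp: E_def)
      finally show ?thesis .
    qed
    have le: "f (T \<inter> F) + f (T - F) \<le> f T + ennreal (\<Sum>k. a (k + n))" for n
    proof -
      have "f (T \<inter> F) + f (T - F) \<le> f (T \<inter> F) + (f (E n) + ennreal (\<Sum>k. a (k + n)))"
        by (intro add_left_mono T_split)
      also have "\<dots> \<le> f T + ennreal (\<Sum>k. a (k + n))"
        using E[of n] by (metis add.assoc add_right_mono)
      finally show ?thesis .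
    qed
    have "(\<lambda>n. f T + ennreal (\<Sum>k. a (k + n))) \<longlonglongrightarrow> f T + ennreal 0"
      by (intro tendsto_add tendsto_const tendsto_ennrealI suminf_exist_split2 summ)
    from LIMSEQ_le_const[OF this] le show ?thesis by auto
  qed
  have "f (T \<inter> F) + f (T - F) = f T" for T
  proof (rule antisym)
    show "f (T \<inter> F) + f (T - F) \<le> f T"
    proof (cases "F = {} \<or> f T = \<infinity>")
      case False
      then show ?thesis using main[of T] by (simp add: less_top)
    qed (auto simp: empty)
    show "f T \<le> f (T \<inter> F) + f (T - F)"
      using sub[of "T \<inter> F" "T - F"] by (simp add: Int_Diff_Un)
  qed
  then show ?thesis
    by (simp add: lambda_system_def Int_commute Diff_eq)
qed

lemma metric_outer_measure_borel:
  fixes f :: "'a::metric_space set \<Rightarrow> ennreal"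
  assumes oms: "outer_measure_space UNIV f"
    and metric: "\<And>A B d. 0 < d \<Longrightarrow> (\<And>x y. x \<in> A \<Longrightarrow> y \<in> B \<Longrightarrow> d \<le> dist x y) \<Longrightarrow>
                   f A + f B \<le> f (A \<union> B)"
  shows "measure_space UNIV (sets borel) f"
proof -
  have L: "measure_space UNIV (lambda_system UNIV UNIV f) f"
    using sigma_algebra.caratheodory_lemma[OF sigma_algebra_Pow[of UNIV]] oms by simp
  then interpret L: sigma_algebra UNIV "lambda_system UNIV UNIV f"
    by (simp add: measure_space_def)
  have "sets borel \<subseteq> lambda_system UNIV UNIV f"
    unfolding borel_eq_closed
    using L.sigma_sets_subset[of "Collect closed"]
      metric_outer_measure_closed_in_lambda_system[OF oms metric]
    by (simp add: subset_eq)
  with measure_down[OF L] show ?thesis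
    by (metis sets.sigma_algebra_axioms space_borel)
qed

lemma hausdorff_content_le:
  fixes C :: "nat \<Rightarrow> 'a::metric_space set"
  assumes "A \<subseteq> (\<Union>i. C i)" and "\<And>i. bounded (C i)" and "\<And>i. diameter (C i) \<le> \<delta>"
  shows "hausdorff_content s \<delta> A \<le> (\<Sum>i. ennreal (unit_ball_vol (real s) / 2 ^ s * diam_pow s (C i)))"
  unfolding hausdorff_content_def by (rule INF_lower) (use assms in auto)

lemma hausdorff_content_empty: "0 \<le> \<delta> \<Longrightarrow> hausdorff_content s \<delta> {} = 0"
  using hausdorff_content_le[of "{}" "\<lambda>_. {}" \<delta> s] by (simp add: diam_pow_def)

lemma hausdorff_content_mono: "A \<subseteq> B \<Longrightarrow> hausdorff_content s \<delta> A \<le> hausdorff_content s \<delta> B"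
  unfolding hausdorff_content_def by (rule INF_superset_mono) auto

lemma hausdorff_content_antimono: "\<delta> \<le> \<epsilon> \<Longrightarrow> hausdorff_content s \<epsilon> A \<le> hausdorff_content s \<delta> A"
  unfolding hausdorff_content_def by (rule INF_superset_mono) (auto intro: order_trans)

lemma hausdorff_content_le_outer: "0 < \<delta> \<Longrightarrow> hausdorff_content s \<delta> A \<le> hausdorff_outer s A"
  unfolding hausdorff_outer_def by (rule SUP_upper) simp

text \<open>Near-optimal covers of the \<open>A n\<close>, the \<open>n\<close>-th one up to an error of
  \<open>e / 2 ^ Suc n\<close>, are merged into one sequence by the pairing function.\<close>

lemma hausdorff_content_countably_subadditive:
  fixes A :: "nat \<Rightarrow> 'a::metric_space set"
  shows "hausdorff_content s \<delta> (\<Union>i. A i) \<le> (\<Sum>i. hausdorff_content s \<delta> (A i))"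
proof (rule ennreal_le_epsilon)
  let ?c = "hausdorff_content s \<delta>"
  let ?f = "\<lambda>C :: 'a set. ennreal (unit_ball_vol (real s) / 2 ^ s * diam_pow s C)"
  fix e :: real assume fin: "(\<Sum>i. ?c (A i)) < top" and e: "0 < e"
  have "\<exists>C. A n \<subseteq> (\<Union>i. C i) \<and> (\<forall>i. bounded (C i) \<and> diameter (C i) \<le> \<delta>) \<and>
            (\<Sum>i. ?f (C i)) \<le> ?c (A n) + ennreal (e * (1/2) ^ Suc n)" for n
  proof -
    have "?c (A n) < ?c (A n) + ennreal (e * (1/2) ^ Suc n)"
      using fin e by (auto simp add: less_top dest!: ennreal_suminf_lessD)
    then show ?thesis
      unfolding hausdorff_content_def INF_less_iff
      by (metis (no_types, lifting) mem_Collect_eq less_imp_le)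
  qed
  then obtain B where B: "\<And>n. A n \<subseteq> (\<Union>i. B n i)" "\<And>n i. bounded (B n i)"
      "\<And>n i. diameter (B n i) \<le> \<delta>"
      "\<And>n. (\<Sum>i. ?f (B n i)) \<le> ?c (A n) + ennreal (e * (1/2) ^ Suc n)"
    by metis
  define C where "C i = (case prod_decode i of (m, n) \<Rightarrow> B m n)" for i
  have "?c (\<Union>i. A i) \<le> (\<Sum>i. ?f (C i))"
  proof (rule hausdorff_content_le)
    show "(\<Union>i. A i) \<subseteq> (\<Union>i. C i)"
      using B(1) by (auto simp add: C_def subset_eq) (metis prod.case prod_encode_inverse)
  qed (auto simp: C_def B split: prod.split)
  also have "\<dots> = (\<Sum>n. \<Sum>i. ?f (B n i))"
    using suminf_ennreal_2dimen[of "\<lambda>m. \<Sum>n. ?f (B m n)" "\<lambda>(m, n). ?f (B m n)"]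
    by (simp add: C_def split_def)
  also have "\<dots> \<le> (\<Sum>n. ?c (A n) + ennreal (e * (1/2) ^ Suc n))"
    by (intro suminf_le B allI) auto
  also have "\<dots> = (\<Sum>n. ?c (A n)) + (\<Sum>n. ennreal (e * (1/2) ^ Suc n))"
    by (rule suminf_add[symmetric]) auto
  also have "(\<Sum>n. ennreal (e * (1/2) ^ Suc n)) = ennreal e"
    using sums_mult[OF power_half_series, of e] e by (intro suminf_ennreal_eq) auto
  finally show "?c (\<Union>i. A i) \<le> (\<Sum>i. ?c (A i)) + ennreal e" .
qed

text \<open>A covering set of diameter less than \<open>d\<close> cannot meet both \<open>A\<close> and \<open>B\<close>, so every
  admissible cover of the union falls apart into a cover of \<open>A\<close> and a cover of \<open>B\<close>.\<close>

lemma hausdorff_content_metric: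
  fixes A B :: "'a::metric_space set"
  assumes sep: "\<And>x y. x \<in> A \<Longrightarrow> y \<in> B \<Longrightarrow> d \<le> dist x y" and "\<delta> < d"
  shows "hausdorff_content s \<delta> A + hausdorff_content s \<delta> B \<le> hausdorff_content s \<delta> (A \<union> B)"
  unfolding hausdorff_content_def[of s \<delta> "A \<union> B"]
proof (rule INF_greatest)
  let ?f = "\<lambda>C :: 'a set. ennreal (unit_ball_vol (real s) / 2 ^ s * diam_pow s C)"
  fix C :: "nat \<Rightarrow> 'a set"
  assume "C \<in> {C. A \<union> B \<subseteq> (\<Union>i. C i) \<and> (\<forall>i. bounded (C i) \<and> diameter (C i) \<le> \<delta>)}"
  then have cov: "A \<union> B \<subseteq> (\<Union>i. C i)" and bd: "\<And>i. bounded (C i)"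
    and dm: "\<And>i. diameter (C i) \<le> \<delta>" by auto
  define P where "P X i = (if C i \<inter> X = {} then {} else C i)" for X i
  have c: "hausdorff_content s \<delta> X \<le> (\<Sum>i. ?f (P X i))" if "X \<subseteq> A \<union> B" for X
  proof (rule hausdorff_content_le)
    show "X \<subseteq> (\<Union>i. P X i)" using that cov by (fastforce simp: P_def)
    show "diameter (P X i) \<le> \<delta>" for i
      using dm[of i] diameter_ge_0[OF bd[of i]] by (simp add: P_def)
  qed (auto simp: P_def bd)
  have le: "?f (P A i) + ?f (P B i) \<le> ?f (C i)" for i
  proof -
    have "C i \<inter> A = {} \<or> C i \<inter> B = {}"
    proof (rule ccontr)
      assume "\<not> ?thesis"
      then obtain x y where "x \<in> C i" "x \<in> A" "y \<in> C i" "y \<in> B" by blast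
      then show False
        using sep[of x y] dm[of i] diameter_bounded_bound[OF bd[of i], of x y] \<open>\<delta> < d\<close> by linarith
    qed
    then show ?thesis by (auto simp: P_def diam_pow_def)
  qed
  have "hausdorff_content s \<delta> A + hausdorff_content s \<delta> B \<le> (\<Sum>i. ?f (P A i)) + (\<Sum>i. ?f (P B i))"
    by (intro add_mono c) auto
  also have "\<dots> = (\<Sum>i. ?f (P A i) + ?f (P B i))"
    by (rule suminf_add) auto
  also have "\<dots> \<le> (\<Sum>i. ?f (C i))"
    by (intro suminf_le le) auto
  finally show "hausdorff_content s \<delta> A + hausdorff_content s \<delta> B \<le> (\<Sum>i. ?f (C i))" .
qed

lemma hausdorff_outer_metric:
  fixes A B :: "'a::metric_space set"
  assumes "0 < d" and sep: "\<And>x y. x \<in> A \<Longrightarrow> y \<in> B \<Longrightarrow> d \<le> dist x y"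
  shows "hausdorff_outer s A + hausdorff_outer s B \<le> hausdorff_outer s (A \<union> B)"
proof -
  have "hausdorff_content s \<delta> A + hausdorff_content s \<epsilon> B \<le> hausdorff_outer s (A \<union> B)"
    if "0 < \<delta>" "0 < \<epsilon>" for \<delta> \<epsilon>
  proof -
    define \<eta> where "\<eta> = min (min \<delta> \<epsilon>) (d / 2)"
    have \<eta>: "0 < \<eta>" "\<eta> < d" "\<eta> \<le> \<delta>" "\<eta> \<le> \<epsilon>" using that \<open>0 < d\<close> by (auto simp: \<eta>_def)
    have "hausdorff_content s \<delta> A + hausdorff_content s \<epsilon> B
        \<le> hausdorff_content s \<eta> A + hausdorff_content s \<eta> B"
      by (intro add_mono hausdorff_content_antimono \<eta>)
    also have "\<dots> \<le> hausdorff_content s \<eta> (A \<union> B)"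
      using sep \<eta> by (intro hausdorff_content_metric) auto
    also have "\<dots> \<le> hausdorff_outer s (A \<union> B)"
      by (intro hausdorff_content_le_outer \<eta>)
    finally show ?thesis .
  qed
  then show ?thesis
    unfolding hausdorff_outer_def[of s A] hausdorff_outer_def[of s B]
    by (subst ennreal_SUP_add_left[symmetric], simp, intro SUP_least,
        subst ennreal_SUP_add_right, simp, intro SUP_least) auto
qed

lemma hausdorff_outer_measure_space:
  "outer_measure_space UNIV (hausdorff_outer s :: 'a::metric_space set \<Rightarrow> ennreal)"
  unfolding outer_measure_space_def
proof (intro conjI)
  show "positive UNIV (hausdorff_outer s :: 'a set \<Rightarrow> ennreal)"
    by (simp add: positive_def hausdorff_outer_def hausdorff_content_empty)
  show "increasing UNIV (hausdorff_outer s :: 'a set \<Rightarrow> ennreal)"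
    unfolding increasing_def hausdorff_outer_def
    by (auto intro!: SUP_mono' hausdorff_content_mono)
  show "countably_subadditive UNIV (hausdorff_outer s :: 'a set \<Rightarrow> ennreal)"
    unfolding countably_subadditive_def
  proof safe
    fix A :: "nat \<Rightarrow> 'a set"
    show "hausdorff_outer s (\<Union>i. A i) \<le> (\<Sum>i. hausdorff_outer s (A i))"
      unfolding hausdorff_outer_def[of s "\<Union>i. A i"]
    proof (rule SUP_least)
      fix \<delta> :: real assume "\<delta> \<in> {0<..}"
      then show "hausdorff_content s \<delta> (\<Union>i. A i) \<le> (\<Sum>i. hausdorff_outer s (A i))"
        by (intro order_trans[OF hausdorff_content_countably_subadditive] suminf_le
              hausdorff_content_le_outer) auto
    qed
  qed
qed

lemma sets_hausdorff_measure [simp]: "sets (hausdorff_measure s) = sets borel"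
  unfolding hausdorff_measure_def
  by (metis sets.sigma_sets_eq sets_measure_of space_borel subset_UNIV Pow_UNIV)

lemma space_hausdorff_measure [simp]: "space (hausdorff_measure s) = UNIV"
  by (simp add: hausdorff_measure_def space_measure_of_conv)

text \<open>The point is that \<^const>\<open>measure_of\<close> returns the null measure when the given function is
  not countably additive.\<close>

lemma emeasure_hausdorff_measure:
  fixes A :: "'a::metric_space set"
  assumes "A \<in> sets borel"
  shows "emeasure (hausdorff_measure s) A = hausdorff_outer s A"
proof -
  have "measure_space UNIV (sets borel) (hausdorff_outer s :: 'a set \<Rightarrow> ennreal)"
    by (rule metric_outer_measure_borel[OF hausdorff_outer_measure_space])
       (rule hausdorff_outer_metric)
  then show ?thesis
    unfolding hausdorff_measure_def using assms
    by (intro emeasure_measure_of_sigma) (auto simp: measure_space_def)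
qed


section \<open>The surface measure of the sphere\<close>

lemma hausdorff_content_le_finite_cover:
  fixes C :: "'i \<Rightarrow> 'a::metric_space set"
  assumes "finite I" and cov: "A \<subseteq> (\<Union>i\<in>I. C i)" and bd: "\<And>i. i \<in> I \<Longrightarrow> bounded (C i)"
    and dm: "\<And>i. i \<in> I \<Longrightarrow> diameter (C i) \<le> \<delta>" and "0 \<le> \<delta>"
  shows "hausdorff_content s \<delta> A \<le> (\<Sum>i\<in>I. ennreal (unit_ball_vol (real s) / 2 ^ s * diam_pow s (C i)))"
proof -
  let ?f = "\<lambda>C :: 'a set. ennreal (unit_ball_vol (real s) / 2 ^ s * diam_pow s C)"
  obtain h where h: "bij_betw h {0..<card I} I"
    using ex_bij_betw_nat_finite[OF \<open>finite I\<close>] by blast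
  have hI: "h n \<in> I" if "n < card I" for n using h that by (auto simp: bij_betw_def)
  define D where "D n = (if n < card I then C (h n) else {})" for n
  have "hausdorff_content s \<delta> A \<le> (\<Sum>n. ?f (D n))"
  proof (rule hausdorff_content_le)
    show "A \<subseteq> (\<Union>n. D n)"
    proof
      fix x assume "x \<in> A"
      then obtain i where i: "i \<in> I" "x \<in> C i" using cov by blast
      then obtain n where "n < card I" "h n = i"
        using h by (metis atLeastLessThan_iff bij_betw_def image_iff)
      then have "x \<in> D n" using i by (simp add: D_def)
      then show "x \<in> (\<Union>n. D n)" by blast
    qed
  qed (use hI bd dm \<open>0 \<le> \<delta>\<close> in \<open>auto simp: D_def\<close>)
  also have "\<dots> = (\<Sum>n\<in>{0..<card I}. ?f (D n))"
    by (rule suminf_finite) (auto simp: D_def diam_pow_def)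
  also have "\<dots> = (\<Sum>n\<in>{0..<card I}. ?f (C (h n)))"
    by (rule sum.cong) (auto simp: D_def)
  also have "\<dots> = (\<Sum>i\<in>I. ?f (C i))"
    by (rule sum.reindex_bij_betw[OF h])
  finally show ?thesis .
qed

text \<open>On the part of the sphere where the \<open>j\<close>-th coordinate dominates and has a fixed sign, that
  coordinate is a Lipschitz function of the others: by \<open>\<Sum>v\<^sub>i\<^sup>2 = \<Sum>w\<^sub>i\<^sup>2\<close> the product
  \<open>(v\<^sub>j - w\<^sub>j) * (v\<^sub>j + w\<^sub>j)\<close> equals the negative of the sum of the products
  \<open>(v\<^sub>i - w\<^sub>i) * (v\<^sub>i + w\<^sub>i)\<close> over the remaining \<open>i\<close>, and \<open>\<bar>v\<^sub>i + w\<^sub>i\<bar> \<le> \<bar>v\<^sub>j + w\<^sub>j\<bar>\<close>.\<close>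

lemma dist_sphere_le_off_dominant_coordinate:
  fixes v w :: "real^'n"
  assumes v: "norm v = 1" and w: "norm w = 1"
    and dom: "\<And>i. \<bar>v $ i\<bar> \<le> \<bar>v $ j\<bar>" "\<And>i. \<bar>w $ i\<bar> \<le> \<bar>w $ j\<bar>"
    and sign: "0 \<le> v $ j * w $ j"
  shows "dist v w \<le> 2 * (\<Sum>i\<in>UNIV - {j}. \<bar>v $ i - w $ i\<bar>)"
proof -
  let ?T = "\<Sum>i\<in>UNIV - {j}. \<bar>v $ i - w $ i\<bar>"
  define D where "D = \<bar>v $ j\<bar> + \<bar>w $ j\<bar>"
  have "v $ j \<noteq> 0"
  proof
    assume "v $ j = 0"
    then have "v = 0" using dom(1) by (simp add: vec_eq_iff)
    then show False using v by simp
  qed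
  then have "0 < D" by (simp add: D_def add_pos_nonneg)
  have D: "\<bar>v $ j + w $ j\<bar> = D"
    using sign unfolding D_def by (auto simp: zero_le_mult_iff)
  have sq: "(\<Sum>i\<in>UNIV. (u $ i)\<^sup>2) = 1" if "norm u = 1" for u :: "real^'n"
    using that by (simp add: norm_vec_def L2_set_def)
  have "0 = (\<Sum>i\<in>UNIV. (v $ i)\<^sup>2) - (\<Sum>i\<in>UNIV. (w $ i)\<^sup>2)"
    using sq v w by simp
  also have "\<dots> = (\<Sum>i\<in>UNIV. (v $ i - w $ i) * (v $ i + w $ i))"
    by (simp add: sum_subtractf[symmetric] power2_eq_square algebra_simps)
  also have "\<dots> = (v $ j - w $ j) * (v $ j + w $ j) +
      (\<Sum>i\<in>UNIV - {j}. (v $ i - w $ i) * (v $ i + w $ i))"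
    by (subst sum.remove[of _ j]) auto
  finally have "\<bar>(v $ j - w $ j) * (v $ j + w $ j)\<bar> =
      \<bar>\<Sum>i\<in>UNIV - {j}. (v $ i - w $ i) * (v $ i + w $ i)\<bar>"
    by linarith
  also have "\<dots> \<le> (\<Sum>i\<in>UNIV - {j}. \<bar>v $ i - w $ i\<bar> * D)"
  proof (rule order_trans[OF sum_abs], rule sum_mono)
    fix i
    have "\<bar>v $ i + w $ i\<bar> \<le> D"
      using dom(1)[of i] dom(2)[of i] unfolding D_def by linarith
    then show "\<bar>(v $ i - w $ i) * (v $ i + w $ i)\<bar> \<le> \<bar>v $ i - w $ i\<bar> * D"
      by (simp add: abs_mult mult_left_mono)
  qed
  finally have "\<bar>v $ j - w $ j\<bar> * D \<le> ?T * D"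
    by (simp add: abs_mult D sum_distrib_right)
  then have "\<bar>v $ j - w $ j\<bar> \<le> ?T" using \<open>0 < D\<close> by simp
  moreover have "dist v w \<le> (\<Sum>i\<in>UNIV. \<bar>v $ i - w $ i\<bar>)"
    using norm_le_l1_cart[of "v - w"] by (simp add: dist_norm)
  moreover have "(\<Sum>i\<in>UNIV. \<bar>v $ i - w $ i\<bar>) = \<bar>v $ j - w $ j\<bar> + ?T"
    by (subst sum.remove[of _ j]) auto
  ultimately show ?thesis by simp
qed

text \<open>For each choice of the dominant coordinate and of its sign, a grid of mesh \<open>2 / N\<close> in
  the other \<open>n - 1\<close> coordinates cuts the sphere into cells of diameter at most \<open>4 * n / N\<close>.
  There are \<open>2 * n * (N + 1) ^ (n - 1)\<close> of them, so that the covering sums remain bounded as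
  \<open>N\<close> grows.\<close>

lemma sphere_hausdorff_outer_finite:
  "hausdorff_outer (CARD('n) - 1) (sphere 0 1 :: (real^'n) set) < \<infinity>"
proof -
  define n where "n = CARD('n)"
  define s where "s = n - 1"
  define u where "u = unit_ball_vol (real s) / 2 ^ s"
  have "0 < n" by (simp add: n_def)
  have "0 \<le> u" by (simp add: u_def)
  define K where "K = real n * 2 * (u * (8 * real n) ^ s)"
  have "hausdorff_content s \<delta> (sphere 0 1 :: (real^'n) set) \<le> ennreal K" if "0 < \<delta>" for \<delta>
  proof -
    obtain N :: nat where N: "4 * real n / \<delta> < real N" "0 < N"
      by (metis reals_Archimedean2 gr0I of_nat_0 \<open>0 < \<delta>\<close> \<open>0 < n\<close> divide_pos_pos less_asym mult_pos_pos of_nat_0_less_iff zero_less_numeral)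
    define \<rho> where "\<rho> = 4 * real n / real N"
    have "\<rho> \<le> \<delta>" "0 \<le> \<rho>" using N \<open>0 < \<delta>\<close> by (auto simp: \<rho>_def field_simps)
    define cell :: "'n \<times> bool \<times> ('n \<Rightarrow> nat) \<Rightarrow> (real^'n) set" where
      "cell = (\<lambda>(j, b, m). {w. norm w = 1 \<and> (\<forall>i. \<bar>w $ i\<bar> \<le> \<bar>w $ j\<bar>) \<and> (b \<longleftrightarrow> 0 \<le> w $ j) \<and>
          (\<forall>i. i \<noteq> j \<longrightarrow> real (m i) \<le> (w $ i + 1) * N / 2 \<and> (w $ i + 1) * N / 2 \<le> real (m i) + 1)})"
    define I :: "('n \<times> bool \<times> ('n \<Rightarrow> nat)) set" where
      "I = (SIGMA j:UNIV. UNIV \<times> (UNIV - {j} \<rightarrow>\<^sub>E {..N}))"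
    have fin: "finite I"
      unfolding I_def by (intro finite_SigmaI finite_PiE) auto
    have card: "card I = n * (2 * (N + 1) ^ s)"
      unfolding I_def by (simp add: card_SigmaI finite_PiE card_cartesian_product card_PiE card_Diff_singleton n_def s_def)
    have close: "dist v w \<le> \<rho>" if "v \<in> cell p" "w \<in> cell p" for v w p
    proof -
      obtain j b m where p: "p = (j, b, m)" by (cases p)
      have "dist v w \<le> 2 * (\<Sum>i\<in>UNIV - {j}. \<bar>v $ i - w $ i\<bar>)"
        using that unfolding p cell_def
        by (intro dist_sphere_le_off_dominant_coordinate) (auto simp: zero_le_mult_iff)
      also have "\<dots> \<le> 2 * (\<Sum>i\<in>UNIV - {j}. 2 / real N)"
      proof (intro mult_left_mono sum_mono)
        fix i assume "i \<in> UNIV - {j}"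
        then have "\<bar>(v $ i + 1) * N / 2 - (w $ i + 1) * N / 2\<bar> \<le> 1"
          using that unfolding p cell_def by fastforce
        also have "(v $ i + 1) * N / 2 - (w $ i + 1) * N / 2 = (v $ i - w $ i) * (N / 2)"
          by (simp add: field_simps)
        finally have "\<bar>v $ i - w $ i\<bar> * (real N / 2) \<le> 1"
          by (simp add: abs_mult)
        then show "\<bar>v $ i - w $ i\<bar> \<le> 2 / real N"
          using \<open>0 < N\<close> by (simp add: field_simps)
      qed simp
      also have "\<dots> = real s * (4 / N)"
        by (simp add: s_def n_def card_Diff_singleton)
      also have "\<dots> \<le> real n * (4 / N)"
        by (intro mult_right_mono) (auto simp: s_def)
      finally show ?thesis by (simp add: \<rho>_def field_simps)
    qed
    have diam: "diameter (cell p) \<le> \<rho>" for p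
      using close \<open>0 \<le> \<rho>\<close> by (intro diameter_le) (auto simp: dist_norm)
    have bd: "bounded (cell p)" for p
      by (rule bounded_subset[OF bounded_sphere[of 0 1]]) (auto simp: cell_def split: prod.splits)
    have cover: "sphere 0 1 \<subseteq> (\<Union>p\<in>I. cell p)"
    proof
      fix w :: "real^'n" assume "w \<in> sphere 0 1"
      then have nw: "norm w = 1" by simp
      obtain j where j: "\<And>i. \<bar>w $ i\<bar> \<le> \<bar>w $ j\<bar>"
      proof -
        have "Max (range (\<lambda>i. \<bar>w $ i\<bar>)) \<in> range (\<lambda>i. \<bar>w $ i\<bar>)" by (rule Max_in) auto
        then obtain j where "Max (range (\<lambda>i. \<bar>w $ i\<bar>)) = \<bar>w $ j\<bar>" by (rule imageE)
        from this[symmetric] show thesis by (intro that[of j]) (simp add: Max_ge)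
      qed
      define m where "m = restrict (\<lambda>i. nat \<lfloor>(w $ i + 1) * N / 2\<rfloor>) (UNIV - {j})"
      have range: "0 \<le> (w $ i + 1) * N / 2" "(w $ i + 1) * N / 2 \<le> N" for i
      proof -
        have w: "-1 \<le> w $ i" "w $ i \<le> 1"
          using component_le_norm_cart[of w i] nw by (auto simp: abs_le_iff)
        show "0 \<le> (w $ i + 1) * N / 2" using w by simp
        show "(w $ i + 1) * N / 2 \<le> N" using w mult_right_mono[of "w $ i + 1" 2 "real N"] by simp
      qed
      have "m i \<le> N" if "i \<noteq> j" for i
        using that range[of i] unfolding m_def by (simp add: nat_le_iff) linarith
      then have "(j, 0 \<le> w $ j, m) \<in> I"
        by (auto simp: I_def m_def)
      moreover have "w \<in> cell (j, 0 \<le> w $ j, m)"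
      proof -
        have "real (m i) \<le> (w $ i + 1) * N / 2 \<and> (w $ i + 1) * N / 2 \<le> real (m i) + 1"
          if "i \<noteq> j" for i
        proof -
          have "real (m i) = of_int \<lfloor>(w $ i + 1) * N / 2\<rfloor>"
            using that range(1)[of i] by (simp add: m_def)
          then show ?thesis by linarith
        qed
        then show ?thesis using nw j by (auto simp: cell_def)
      qed
      ultimately show "w \<in> (\<Union>p\<in>I. cell p)" by blast
    qed
    have "hausdorff_content s \<delta> (sphere 0 1 :: (real^'n) set) \<le>
        (\<Sum>p\<in>I. ennreal (unit_ball_vol (real s) / 2 ^ s * diam_pow s (cell p)))"
      using diam \<open>\<rho> \<le> \<delta>\<close> \<open>0 < \<delta>\<close>
      by (intro hausdorff_content_le_finite_cover fin cover bd) (auto intro: order_trans)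
    also have "\<dots> \<le> (\<Sum>p\<in>I. ennreal (u * \<rho> ^ s))"
      using \<open>0 \<le> \<rho>\<close> \<open>0 \<le> u\<close> diam diameter_ge_0[OF bd]
      by (intro sum_mono ennreal_leI) (auto simp: u_def[symmetric] diam_pow_def intro!: mult_left_mono power_mono)
    also have "\<dots> = ennreal (real (card I) * (u * \<rho> ^ s))"
      by (simp add: ennreal_mult' ennreal_of_nat_eq_real_of_nat)
    also have "\<dots> \<le> ennreal K"
    proof (rule ennreal_leI)
      have "(real N + 1) * \<rho> \<le> 8 * real n"
        using \<open>0 < N\<close> mult_left_mono[of 1 "real N" "real n"] by (simp add: \<rho>_def field_simps)
      then have "((real N + 1) * \<rho>) ^ s \<le> (8 * real n) ^ s"
        using \<open>0 \<le> \<rho>\<close> by (intro power_mono) auto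
      then have "real n * 2 * (u * ((real N + 1) ^ s * \<rho> ^ s)) \<le> K"
        unfolding K_def power_mult_distrib[of "real N + 1"] using \<open>0 \<le> u\<close> by (intro mult_left_mono) auto
      then show "real (card I) * (u * \<rho> ^ s) \<le> K"
        by (simp add: card ac_simps)
    qed
    finally show ?thesis .
  qed
  then have "hausdorff_outer s (sphere 0 1 :: (real^'n) set) \<le> ennreal K"
    unfolding hausdorff_outer_def by (intro SUP_least) auto
  also have "\<dots> < \<infinity>" by simp
  finally show ?thesis by (simp add: s_def n_def)
qed

text \<open>Boxes with unit side in direction \<open>k\<close> turn \<open>(n - 1)\<close>-dimensional volumes into
  \<open>n\<close>-dimensional ones: they represent subsets of the hyperplane orthogonal to direction \<open>k\<close>
  without a second vector type of smaller dimension.\<close>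

lemma emeasure_lborel_slab:
  fixes z :: "'n::finite \<Rightarrow> real" and k :: 'n
  assumes "0 \<le> c"
  shows "emeasure lborel (cbox (\<chi> i. if i = k then 0 else z i - c) (\<chi> i. if i = k then 1 else z i + c))
           = ennreal ((2 * c) ^ (CARD('n) - 1))" (is "emeasure lborel ?Q = _")
proof -
  have ne: "?Q \<noteq> {}" using assms by (auto simp: interval_ne_empty_cart)
  have "measure lborel ?Q = (\<Prod>i\<in>UNIV. if i = k then 1 else 2 * c)"
    by (subst content_cbox_cart[OF ne], rule prod.cong) auto
  also have "\<dots> = (\<Prod>i\<in>UNIV - {k}. 2 * c)"
    by (subst prod.remove[of _ k]) auto
  also have "\<dots> = (2 * c) ^ (CARD('n) - 1)"
    by (simp add: card_Diff_singleton)
  finally show ?thesis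
    using emeasure_lborel_cbox_finite[of "\<chi> i. if i = k then 0 else z i - c" "\<chi> i. if i = k then 1 else z i + c"]
    by (subst emeasure_eq_ennreal_measure) (auto simp: less_top)
qed

text \<open>The orthogonal projection along direction \<open>k\<close> does not increase distances and maps the
  two caps onto a neighbourhood of the origin in the hyperplane. Thickened in direction \<open>k\<close>,
  the projection of a covering set of diameter \<open>d\<close> fits into a slab of volume
  \<open>(2 * d) ^ (n - 1)\<close>, and these slabs cover a fixed slab around the origin. Lebesgue measure
  therefore bounds the covering sums from below.\<close>

lemma sphere_caps_hausdorff_outer_pos:
  fixes k :: "'n::finite"
  shows "0 < hausdorff_outer (CARD('n) - 1) {w :: real^'n. norm w = 1 \<and> 1 / 2 \<le> \<bar>w $ k\<bar>}"
    (is "0 < hausdorff_outer _ ?A")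
proof -
  define n where "n = CARD('n)"
  define s where "s = n - 1"
  define u where "u = unit_ball_vol (real s) / 2 ^ s"
  have "0 < n" by (simp add: n_def)
  have "0 < u" by (simp add: u_def)
  \<comment> \<open>So small that \<open>n * a\<^sup>2 \<le> 3 / 4\<close>: points of the hyperplane with coordinates bounded by
    \<open>a\<close> lift to points of the sphere whose \<open>k\<close>-th coordinate is at least \<open>1 / 2\<close>.\<close>
  define a where "a = 1 / (2 * real n)"
  have "0 < a" using \<open>0 < n\<close> by (simp add: a_def)
  define slab where "slab z c = cbox (\<chi> i. if i = k then 0 else z $ i - c) (\<chi> i. if i = k then 1 else z $ i + c)"
    for z :: "real^'n" and c
  have slab: "emeasure lborel (slab z c) = ennreal ((2 * c) ^ s)" if "0 \<le> c" for z c
    using emeasure_lborel_slab[OF that, of k "\<lambda>i. z $ i"] by (simp add: slab_def s_def n_def)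
  have mem: "y \<in> slab z c \<longleftrightarrow> 0 \<le> y $ k \<and> y $ k \<le> 1 \<and> (\<forall>i. i \<noteq> k \<longrightarrow> \<bar>y $ i - z $ i\<bar> \<le> c)" for y z c
    by (auto simp: slab_def mem_box_cart abs_le_iff algebra_simps split: if_splits)
  have "ennreal (u / 2 ^ s * (2 * a) ^ s) \<le> hausdorff_content s 1 ?A"
    unfolding hausdorff_content_def
  proof (rule INF_greatest)
    fix C :: "nat \<Rightarrow> (real^'n) set"
    assume "C \<in> {C. ?A \<subseteq> (\<Union>i. C i) \<and> (\<forall>i. bounded (C i) \<and> diameter (C i) \<le> 1)}"
    then have cov: "?A \<subseteq> (\<Union>i. C i)" and bd: "\<And>i. bounded (C i)" by auto
    \<comment> \<open>An empty covering set counts \<open>0\<close> also in dimension \<open>s = 0\<close>, so it must get an empty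
    slab: a slab of radius \<open>0\<close> has volume \<open>0 ^ 0 = 1\<close> there.\<close>
    define B where "B i = (if C i = {} then {} else slab (SOME c. c \<in> C i) (diameter (C i)))" for i
    have B: "emeasure lborel (B i) = ennreal (2 ^ s * diam_pow s (C i))" for i
      using slab[OF diameter_ge_0[OF bd[of i]]] by (simp add: B_def diam_pow_def power_mult_distrib)
    have "slab 0 a \<subseteq> (\<Union>i. B i)"
    proof
      fix y assume y: "y \<in> slab 0 a"
      define q where "q = (\<Sum>i\<in>UNIV - {k}. (y $ i)\<^sup>2)"
      have "q \<le> (\<Sum>i\<in>UNIV - {k}. a\<^sup>2)"
        unfolding q_def using y by (intro sum_mono) (auto simp: mem abs_le_square_iff[symmetric] \<open>0 < a\<close> less_imp_le)
      also have "\<dots> \<le> real n * a\<^sup>2"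
        by (simp add: card_Diff_singleton n_def mult_right_mono)
      also have "\<dots> = 1 / (4 * real n)" using \<open>0 < n\<close> by (simp add: a_def power2_eq_square field_simps)
      also have "\<dots> \<le> 3 / 4" using \<open>0 < n\<close> by (simp add: field_simps)
      finally have q: "q \<le> 3 / 4" .
      define w where "w = (\<chi> i. if i = k then sqrt (1 - q) else y $ i)"
      have "(\<Sum>i\<in>UNIV. (w $ i)\<^sup>2) = (w $ k)\<^sup>2 + (\<Sum>i\<in>UNIV - {k}. (w $ i)\<^sup>2)"
        by (rule sum.remove) auto
      also have "\<dots> = 1"
        using q by (simp add: w_def q_def)
      finally have "norm w = 1" by (simp add: norm_vec_def L2_set_def)
      moreover have "1 / 2 \<le> w $ k"
        using q real_le_rsqrt[of "1 / 2" "1 - q"] by (simp add: w_def power2_eq_square)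
      ultimately have "w \<in> ?A" by simp
      then obtain i where i: "w \<in> C i" using cov by blast
      define c where "c = (SOME c. c \<in> C i)"
      have "c \<in> C i" unfolding c_def using i by (rule someI)
      have "\<bar>y $ l - c $ l\<bar> \<le> diameter (C i)" if "l \<noteq> k" for l
      proof -
        have "\<bar>y $ l - c $ l\<bar> = \<bar>(w - c) $ l\<bar>" using that by (simp add: w_def)
        also have "\<dots> \<le> dist w c" unfolding dist_norm by (rule component_le_norm_cart)
        also have "\<dots> \<le> diameter (C i)" by (rule diameter_bounded_bound[OF bd i \<open>c \<in> C i\<close>])
        finally show ?thesis .
      qed
      then have "y \<in> B i" using y i by (auto simp: B_def mem c_def)
      then show "y \<in> (\<Union>i. B i)" by blast
    qed
    then have "emeasure lborel (slab 0 a) \<le> emeasure lborel (\<Union>i. B i)"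
      by (intro emeasure_mono) (auto simp: B_def slab_def)
    also have "\<dots> \<le> (\<Sum>i. emeasure lborel (B i))"
      by (intro emeasure_subadditive_countably) (auto simp: B_def slab_def)
    finally have *: "ennreal ((2 * a) ^ s) \<le> (\<Sum>i. ennreal (2 ^ s * diam_pow s (C i)))"
      using \<open>0 < a\<close> by (simp add: slab B)
    have "ennreal (u / 2 ^ s * (2 * a) ^ s) = ennreal (u / 2 ^ s) * ennreal ((2 * a) ^ s)"
      using \<open>0 < u\<close> \<open>0 < a\<close> by (intro ennreal_mult) auto
    also have "\<dots> \<le> ennreal (u / 2 ^ s) * (\<Sum>i. ennreal (2 ^ s * diam_pow s (C i)))"
      by (intro mult_left_mono *) auto
    also have "\<dots> = (\<Sum>i. ennreal (u / 2 ^ s) * ennreal (2 ^ s * diam_pow s (C i)))"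
      by (rule ennreal_suminf_cmult[symmetric])
    also have "\<dots> = (\<Sum>i. ennreal (unit_ball_vol (real s) / 2 ^ s * diam_pow s (C i)))"
    proof (rule suminf_cong)
      fix i
      have "0 \<le> diam_pow s (C i)" using diameter_ge_0[OF bd[of i]] by (simp add: diam_pow_def)
      then show "ennreal (u / 2 ^ s) * ennreal (2 ^ s * diam_pow s (C i)) =
          ennreal (unit_ball_vol (real s) / 2 ^ s * diam_pow s (C i))"
        using \<open>0 < u\<close> by (subst ennreal_mult[symmetric]) (auto simp: u_def)
    qed
    finally show "ennreal (u / 2 ^ s * (2 * a) ^ s) \<le>
      (\<Sum>i. ennreal (unit_ball_vol (real s) / 2 ^ s * diam_pow s (C i)))" .
  qed
  also have "\<dots> \<le> hausdorff_outer s ?A" by (rule hausdorff_content_le_outer) simp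
  finally have "ennreal (u / 2 ^ s * (2 * a) ^ s) \<le> hausdorff_outer s ?A" .
  moreover have "0 < ennreal (u / 2 ^ s * (2 * a) ^ s)" using \<open>0 < u\<close> \<open>0 < a\<close> by simp
  ultimately show ?thesis unfolding s_def n_def by (rule less_le_trans[rotated])
qed

lemma space_sphere_measure [simp]: "space (sphere_measure :: (real^'n) measure) = sphere 0 1"
  by (simp add: sphere_measure_def space_restrict_space)

lemma borel_measurable_sphere_measure:
  "f \<in> borel_measurable borel \<Longrightarrow> f \<in> borel_measurable (sphere_measure :: (real^'n) measure)"
  unfolding sphere_measure_def
  by (intro measurable_restrict_space1) (simp cong: measurable_cong_sets)

lemma emeasure_sphere_measure:
  fixes A :: "(real^'n) set"
  assumes "A \<in> sets borel" and "A \<subseteq> sphere 0 1"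
  shows "emeasure sphere_measure A = hausdorff_outer (CARD('n) - 1) A"
proof -
  have "emeasure sphere_measure A = emeasure (hausdorff_measure (CARD('n) - 1)) A"
    unfolding sphere_measure_def using assms
    by (intro emeasure_restrict_space) (auto simp: borel_closed)
  then show ?thesis using emeasure_hausdorff_measure[OF assms(1)] by simp
qed

lemma finite_measure_sphere_measure: "finite_measure (sphere_measure :: (real^'n) measure)"
proof
  show "emeasure (sphere_measure :: (real^'n) measure) (space sphere_measure) \<noteq> \<infinity>"
    using sphere_hausdorff_outer_finite[where ?'n = 'n]
    by (simp add: emeasure_sphere_measure borel_closed)
qed

lemma sphere_measure_caps_pos:
  fixes k :: "'n::finite"
  shows "0 < measure (sphere_measure :: (real^'n) measure) {w \<in> space sphere_measure. 1 / 2 \<le> \<bar>w $ k\<bar>}"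
proof -
  interpret finite_measure "sphere_measure :: (real^'n) measure"
    by (rule finite_measure_sphere_measure)
  have eq: "{w \<in> space sphere_measure. 1 / 2 \<le> \<bar>w $ k\<bar>} = {w :: real^'n. norm w = 1 \<and> 1 / 2 \<le> \<bar>w $ k\<bar>}"
    by auto
  have "closed {w :: real^'n. norm w = 1 \<and> 1 / 2 \<le> \<bar>w $ k\<bar>}"
    by (intro closed_Collect_conj closed_Collect_eq closed_Collect_le continuous_intros)
  then have "0 < emeasure (sphere_measure :: (real^'n) measure) {w \<in> space sphere_measure. 1 / 2 \<le> \<bar>w $ k\<bar>}"
    unfolding eq using sphere_caps_hausdorff_outer_pos[of k]
    by (subst emeasure_sphere_measure) (auto simp: borel_closed)
  then show ?thesis by (simp add: emeasure_eq_measure)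
qed


section \<open>Young functions\<close>

lemma young_density_mono:
  "young_density \<phi> \<Longrightarrow> 0 \<le> s \<Longrightarrow> s \<le> t \<Longrightarrow> \<phi> s \<le> \<phi> t"
  by (auto simp: young_density_def mono_on_def)

lemma young_density_nonneg: "young_density \<phi> \<Longrightarrow> 0 \<le> t \<Longrightarrow> 0 \<le> \<phi> t"
  using young_density_mono[of \<phi> 0 t] by (simp add: young_density_def)

text \<open>Replacing \<open>\<phi>\<close> by a constant on the negative half line makes it monotone on all reals
  and hence Borel measurable.\<close>

lemma young_density_set_integrable:
  assumes "young_density \<phi>" and "0 \<le> a" and A: "A \<in> sets borel" "A \<subseteq> {a..b}"
  shows "set_integrable lborel A \<phi>"
proof -
  define \<psi> where "\<psi> x = \<phi> (max 0 x)" for x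
  have "mono \<psi>"
    using young_density_mono[OF assms(1)] by (auto simp: mono_def \<psi>_def max_def)
  then have [measurable]: "\<psi> \<in> borel_measurable lborel"
    by (simp add: borel_measurable_mono)
  have "set_integrable lborel {a..b} \<psi>"
    unfolding set_integrable_def
  proof (rule integrableI_bounded_set_indicator[where B = "\<psi> b"])
    show "AE x in lborel. x \<in> {a..b} \<longrightarrow> norm (\<psi> x) \<le> \<psi> b"
      using \<open>mono \<psi>\<close> young_density_nonneg[OF assms(1)] by (auto simp: mono_def \<psi>_def)
  qed (auto simp: emeasure_lborel_Icc_eq)
  then have "set_integrable lborel A \<psi>"
    using A by (auto intro: set_integrable_subset)
  then show ?thesis
    unfolding set_integrable_def
    by (rule back_subst[of "integrable lborel"])
       (use A \<open>0 \<le> a\<close> in \<open>force simp: \<psi>_def indicator_def fun_eq_iff\<close>)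
qed

text \<open>This two-sided bound, due to the density being monotone, carries all later estimates.\<close>

lemma young_increment:
  assumes "young_with_density \<phi> \<Phi>" and "0 \<le> s" and "s \<le> t"
  shows "(t - s) * \<phi> s \<le> \<Phi> t - \<Phi> s" and "\<Phi> t - \<Phi> s \<le> (t - s) * \<phi> t"
proof -
  have d: "young_density \<phi>" using assms(1) by (simp add: young_with_density_def)
  have int: "set_integrable lborel {0..s} \<phi>" "set_integrable lborel {s<..t} \<phi>"
    using assms by (auto intro!: young_density_set_integrable[OF d, of 0])
  have "{0..t} = {0..s} \<union> {s<..t}" using assms by auto
  moreover have "(LBINT x:{0..s} \<union> {s<..t}. \<phi> x) = (LBINT x:{0..s}. \<phi> x) + (LBINT x:{s<..t}. \<phi> x)"
    by (intro set_integral_Un int) auto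
  ultimately have "\<Phi> t = \<Phi> s + (LBINT x:{s<..t}. \<phi> x)"
    using assms by (simp add: young_with_density_def)
  moreover have const: "(LBINT x:{s<..t}. c) = (t - s) * c" "set_integrable lborel {s<..t} (\<lambda>_. c)" for c :: real
    using assms by (auto simp: set_lebesgue_integral_def set_integrable_def)
  moreover have "(LBINT x:{s<..t}. \<phi> s) \<le> (LBINT x:{s<..t}. \<phi> x)"
    using assms by (intro set_integral_mono const int) (auto intro: young_density_mono[OF d])
  moreover have "(LBINT x:{s<..t}. \<phi> x) \<le> (LBINT x:{s<..t}. \<phi> t)"
    using assms by (intro set_integral_mono const int) (auto intro: young_density_mono[OF d])
  ultimately show "(t - s) * \<phi> s \<le> \<Phi> t - \<Phi> s" "\<Phi> t - \<Phi> s \<le> (t - s) * \<phi> t"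
    by simp_all
qed

lemma set_integral_degenerate_interval:
  fixes f :: "real \<Rightarrow> real"
  assumes "f c = 0"
  shows "(LBINT x:{c..c}. f x) = 0"
proof -
  have "(\<lambda>x. indicator {c..c} x *\<^sub>R f x) = (\<lambda>x. 0)"
    using assms by (auto simp: fun_eq_iff indicator_def)
  then show ?thesis by (simp only: set_lebesgue_integral_def integral_zero)
qed

lemma young_zero:
  assumes "young_with_density \<phi> \<Phi>"
  shows "\<Phi> 0 = 0"
proof -
  have "\<phi> 0 = 0" and "\<Phi> 0 = (LBINT x:{0..0}. \<phi> x)"
    using assms by (simp_all add: young_with_density_def young_density_def)
  then show ?thesis by (simp only: set_integral_degenerate_interval)
qed

lemma young_mono:
  assumes "young_with_density \<phi> \<Phi>" and "0 \<le> s" and "s \<le> t"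
  shows "\<Phi> s \<le> \<Phi> t"
proof -
  have "0 \<le> (t - s) * \<phi> s"
    using assms young_density_nonneg[of \<phi> s] by (simp add: young_with_density_def)
  then show ?thesis using young_increment(1)[OF assms] by linarith
qed

lemma young_nonneg: "young_with_density \<phi> \<Phi> \<Longrightarrow> 0 \<le> t \<Longrightarrow> 0 \<le> \<Phi> t"
  using young_mono[of \<phi> \<Phi> 0 t] young_zero[of \<phi> \<Phi>] by simp

lemma young_le_density: "young_with_density \<phi> \<Phi> \<Longrightarrow> 0 \<le> t \<Longrightarrow> \<Phi> t \<le> t * \<phi> t"
  using young_increment(2)[of \<phi> \<Phi> 0 t] young_zero[of \<phi> \<Phi>] by simp

lemma young_half_ge_density: "young_with_density \<phi> \<Phi> \<Longrightarrow> 0 \<le> t \<Longrightarrow> t / 2 * \<phi> (t / 2) \<le> \<Phi> t"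
  using young_increment(1)[of \<phi> \<Phi> "t / 2" t] young_nonneg[of \<phi> \<Phi> "t / 2"] by simp

lemma young_pos:
  assumes "young_with_density \<phi> \<Phi>" and "0 < t"
  shows "0 < \<Phi> t"
proof -
  have "0 < t / 2 * \<phi> (t / 2)"
    using assms by (simp add: young_with_density_def young_density_def)
  also have "\<dots> \<le> \<Phi> t" using young_half_ge_density assms by simp
  finally show ?thesis .
qed

text \<open>The multiplicative form of the monotonicity of \<open>\<Phi> t / t\<close>.\<close>

lemma young_star_shaped:
  assumes "young_with_density \<phi> \<Phi>" and "0 \<le> s" and "s \<le> t"
  shows "t * \<Phi> s \<le> s * \<Phi> t"
proof -
  have "t * \<Phi> s = s * \<Phi> s + (t - s) * \<Phi> s" by (simp add: algebra_simps)
  also have "\<dots> \<le> s * \<Phi> s + (t - s) * (s * \<phi> s)"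
    using young_le_density[of \<phi> \<Phi> s] assms by (intro add_left_mono mult_left_mono) auto
  also have "\<dots> = s * (\<Phi> s + (t - s) * \<phi> s)" by (simp add: algebra_simps)
  also have "\<dots> \<le> s * \<Phi> t"
    using young_increment(1)[OF assms] assms by (intro mult_left_mono) auto
  finally show ?thesis .
qed

text \<open>The upper growth condition prevents \<open>\<Phi>\<close> from dropping too fast. With \<open>s = 1 - 1 / (2 * q)\<close>,
  where \<open>q\<close> bounds the growth exponent, the increment bound gives
  \<open>\<Phi> t - \<Phi> (s * t) \<le> (1 - s) * t * \<phi> t \<le> (1 - s) * q * \<Phi> t = \<Phi> t / 2\<close>. Shrinking the argument by
  \<open>s\<close> at most halves the value, and finitely many such steps reach \<open>t / 4\<close>. The number of steps
  depends on \<open>p\<close> only, which makes the constant uniform in \<open>\<phi>\<close> and \<open>\<Phi>\<close>.\<close>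

lemma young_quarter_ge:
  fixes p :: real
  obtains c where "0 < c" and
    "\<And>\<phi> \<Phi> t. young_with_density \<phi> \<Phi> \<Longrightarrow> (\<And>t. 0 < t \<Longrightarrow> t * \<phi> t / \<Phi> t \<le> p) \<Longrightarrow> 0 \<le> t \<Longrightarrow>
       c * \<Phi> t \<le> \<Phi> (t / 4)"
proof -
  define q where "q = max p 1"
  define s where "s = 1 - 1 / (2 * q)"
  have "1 \<le> q" by (simp add: q_def)
  then have s: "0 \<le> s" "s < 1" by (auto simp: s_def field_simps)
  then obtain m where m: "s ^ m < 1 / 4"
    using real_arch_pow_inv[of "1 / 4" s] by auto
  show thesis
  proof (rule that[of "(1 / 2) ^ m"])
    fix \<phi> \<Phi> :: "real \<Rightarrow> real" and t :: real
    assume y: "young_with_density \<phi> \<Phi>" and p: "\<And>t. 0 < t \<Longrightarrow> t * \<phi> t / \<Phi> t \<le> p" and "0 \<le> t"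
    have step: "\<Phi> \<tau> / 2 \<le> \<Phi> (s * \<tau>)" if "0 \<le> \<tau>" for \<tau>
    proof (cases "\<tau> = 0")
      case False
      have "s * \<tau> \<le> \<tau>" using s that mult_right_mono[of s 1 \<tau>] by simp
      then have "\<Phi> \<tau> - \<Phi> (s * \<tau>) \<le> (1 - s) * (\<tau> * \<phi> \<tau>)"
        using young_increment(2)[OF y, of "s * \<tau>" \<tau>] s that by (simp add: algebra_simps)
      also have "\<tau> * \<phi> \<tau> \<le> p * \<Phi> \<tau>"
        using p[of \<tau>] young_pos[OF y, of \<tau>] False that by (simp add: divide_le_eq)
      also have "p * \<Phi> \<tau> \<le> q * \<Phi> \<tau>"
        using young_nonneg[OF y that] by (intro mult_right_mono) (auto simp: q_def)
      also have "(1 - s) * (q * \<Phi> \<tau>) = \<Phi> \<tau> / 2"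
        using \<open>1 \<le> q\<close> by (simp add: s_def)
      finally show ?thesis using s by simp
    qed (simp add: young_zero[OF y])
    have "(1 / 2) ^ j * \<Phi> t \<le> \<Phi> (s ^ j * t)" for j
    proof (induction j)
      case (Suc j)
      then show ?case
        using step[of "s ^ j * t"] s \<open>0 \<le> t\<close> by (simp add: mult.assoc)
    qed simp
    also have "\<Phi> (s ^ m * t) \<le> \<Phi> (t / 4)"
      using m s \<open>0 \<le> t\<close> mult_right_mono[of "s ^ m" "1 / 4" t] by (intro young_mono[OF y]) auto
    finally show "(1 / 2) ^ m * \<Phi> t \<le> \<Phi> (t / 4)" .
  qed simp
qed

section \<open>Averages of a Young function over a finite measure\<close>

text \<open>The model case is the surface measure of the sphere with the weight \<open>\<bar>w\<^sub>k\<bar>\<close>. The set where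
  the weight is at least \<open>1 / 2\<close>, the two caps, keeps the averages from being much smaller than \<open>\<Phi>\<close>.\<close>

locale weighted_young = finite_measure M for M :: "'b measure" +
  fixes a :: "'b \<Rightarrow> real" and \<phi> \<Phi> :: "real \<Rightarrow> real"
  assumes a_measurable [measurable]: "a \<in> borel_measurable M"
    and a_range: "\<And>w. w \<in> space M \<Longrightarrow> 0 \<le> a w \<and> a w \<le> 1"
    and a_large: "0 < measure M {w \<in> space M. 1 / 2 \<le> a w}"
    and young: "young_with_density \<phi> \<Phi>"
begin

definition avg :: "real \<Rightarrow> real" where
  "avg u = (\<integral>w. \<Phi> (u * a w) \<partial>M)"

text \<open>The substitution \<open>\<tau> = t * r\<close> turns the integral of \<open>avg (t * r) / r\<close> over \<open>0 < r < 1\<close> into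
  that of \<open>avg \<tau> / \<tau>\<close> over \<open>0 < \<tau> < t\<close>; this is how the quotient arises as a density.\<close>

definition avg_density :: "real \<Rightarrow> real" where
  "avg_density u = (if u \<le> 0 then 0 else avg u / u)"

lemma density: "young_density \<phi>"
  using young by (simp add: young_with_density_def)

lemma scaled_range: "w \<in> space M \<Longrightarrow> 0 \<le> u \<Longrightarrow> 0 \<le> u * a w \<and> u * a w \<le> u"
  using a_range[of w] mult_left_mono[of "a w" 1 u] by simp

lemma integrable_scaled:
  assumes "0 \<le> u"
  shows "integrable M (\<lambda>w. \<Phi> (u * a w))"
proof (rule integrable_const_bound[where B = "\<Phi> u"])
  show "AE w in M. norm (\<Phi> (u * a w)) \<le> \<Phi> u"
    using scaled_range assms by (auto intro!: AE_I2 young_mono[OF young] simp: young_nonneg[OF young])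
  have "mono (\<lambda>x. \<Phi> (max 0 x))"
    using young_mono[OF young] by (auto simp: mono_def max_def)
  then have [measurable]: "(\<lambda>x. \<Phi> (max 0 x)) \<in> borel_measurable borel"
    by (rule borel_measurable_mono)
  have "(\<lambda>w. \<Phi> (max 0 (u * a w))) \<in> borel_measurable M"
    by measurable
  then show "(\<lambda>w. \<Phi> (u * a w)) \<in> borel_measurable M"
    by (subst measurable_cong[where g = "\<lambda>w. \<Phi> (max 0 (u * a w))"])
       (use scaled_range assms in \<open>auto simp: max_def\<close>)
qed

lemma avg_nonneg: "0 \<le> u \<Longrightarrow> 0 \<le> avg u"
  unfolding avg_def
  by (intro Bochner_Integration.integral_nonneg_AE AE_I2 young_nonneg[OF young]) (use scaled_range in auto)

lemma avg_mono: "0 \<le> s \<Longrightarrow> s \<le> t \<Longrightarrow> avg s \<le> avg t"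
  unfolding avg_def
  by (intro integral_mono integrable_scaled young_mono[OF young])
     (use a_range in \<open>auto intro: mult_right_mono\<close>)

lemma avg_increment:
  assumes "0 \<le> s" and "s \<le> t"
  shows "avg t - avg s \<le> (t - s) * \<phi> t * measure M (space M)"
proof -
  have "avg t - avg s = (\<integral>w. \<Phi> (t * a w) - \<Phi> (s * a w) \<partial>M)"
    unfolding avg_def using assms by (intro Bochner_Integration.integral_diff[symmetric] integrable_scaled) auto
  also have "\<dots> \<le> (\<integral>w. (t - s) * \<phi> t \<partial>M)"
  proof (intro integral_mono Bochner_Integration.integrable_diff integrable_scaled integrable_const)
    fix w assume w: "w \<in> space M"
    have "\<Phi> (t * a w) - \<Phi> (s * a w) \<le> (t * a w - s * a w) * \<phi> (t * a w)"
      using a_range[OF w] assms by (intro young_increment(2)[OF young]) (auto intro: mult_right_mono)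
    also have "\<dots> = (t - s) * (a w * \<phi> (t * a w))" by (simp add: algebra_simps)
    also have "\<dots> \<le> (t - s) * (1 * \<phi> t)"
      using a_range[OF w] scaled_range[OF w, of t] assms
      by (intro mult_left_mono mult_mono young_density_mono[OF density] young_density_nonneg[OF density]) auto
    finally show "\<Phi> (t * a w) - \<Phi> (s * a w) \<le> (t - s) * \<phi> t" by simp
  qed (use assms in auto)
  finally show ?thesis by (simp add: ac_simps)
qed

lemma avg_le:
  assumes "0 \<le> u"
  shows "avg u \<le> measure M (space M) * \<Phi> u"
proof -
  have "avg u \<le> (\<integral>w. \<Phi> u \<partial>M)"
    unfolding avg_def using assms scaled_range
    by (intro integral_mono integrable_scaled young_mono[OF young]) auto
  then show ?thesis by simp
qed

lemma avg_ge:
  assumes "0 \<le> u"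
  shows "measure M {w \<in> space M. 1 / 2 \<le> a w} * \<Phi> (u / 2) \<le> avg u" (is "measure M ?A * _ \<le> _")
proof -
  have [measurable]: "?A \<in> sets M" by measurable
  have "measure M ?A * \<Phi> (u / 2) = (\<integral>w. indicator ?A w * \<Phi> (u / 2) \<partial>M)"
    by simp
  also have "\<dots> \<le> avg u"
    unfolding avg_def
  proof (intro integral_mono integrable_scaled assms)
    fix w assume w: "w \<in> space M"
    show "indicator ?A w * \<Phi> (u / 2) \<le> \<Phi> (u * a w)"
    proof (cases "w \<in> ?A")
      case True
      then have "u / 2 \<le> u * a w" using assms mult_left_mono[of "1 / 2" "a w" u] by simp
      then show ?thesis using True assms by (simp add: young_mono[OF young])
    next
      case False
      then show ?thesis using young_nonneg[OF young] scaled_range[OF w assms] by simp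
    qed
  qed (intro integrable_mult_left integrable_real_indicator, auto simp: less_top[symmetric])
  finally show ?thesis .
qed

lemma avg_star_shaped:
  assumes "0 \<le> s" and "s \<le> t"
  shows "t * avg s \<le> s * avg t"
proof -
  have "t * avg s = (\<integral>w. t * \<Phi> (s * a w) \<partial>M)" by (simp add: avg_def)
  also have "\<dots> \<le> (\<integral>w. s * \<Phi> (t * a w) \<partial>M)"
  proof (intro integral_mono integrable_mult_right integrable_scaled)
    fix w assume w: "w \<in> space M"
    have "t * a w * \<Phi> (s * a w) \<le> s * a w * \<Phi> (t * a w)"
      using a_range[OF w] assms by (intro young_star_shaped[OF young]) (auto intro: mult_right_mono)
    then show "t * \<Phi> (s * a w) \<le> s * \<Phi> (t * a w)"
      using a_range[OF w] by (cases "a w = 0") (auto simp: young_zero[OF young])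
  qed (use assms in auto)
  also have "\<dots> = s * avg t" by (simp add: avg_def)
  finally show ?thesis .
qed

lemma avg_density_nonneg: "0 \<le> avg_density t"
  using avg_nonneg[of t] by (simp add: avg_density_def)

lemma avg_density_mono: "mono avg_density"
proof (rule monoI)
  fix s t :: real assume "s \<le> t"
  show "avg_density s \<le> avg_density t"
  proof (cases "0 < s")
    case True
    then show ?thesis
      using avg_star_shaped[of s t] \<open>s \<le> t\<close> by (simp add: avg_density_def field_simps)
  next
    case False
    then have "avg_density s = 0" by (simp add: avg_density_def)
    then show ?thesis using avg_density_nonneg[of t] by simp
  qed
qed

lemma avg_right_continuous:
  assumes "0 \<le> t"
  shows "(avg \<longlongrightarrow> avg t) (at_right t)"
proof (rule tendsto_sandwich)
  show "\<forall>\<^sub>F u in at_right t. avg t \<le> avg u"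
    using assms by (auto simp: eventually_at_filter intro!: avg_mono always_eventually)
  show "\<forall>\<^sub>F u in at_right t. avg u \<le> avg t + (u - t) * \<phi> u * measure M (space M)"
    using avg_increment[OF assms] by (auto simp: eventually_at_filter algebra_simps intro!: always_eventually)
  have "((\<lambda>u. avg t + (u - t) * \<phi> u * measure M (space M)) \<longlongrightarrow>
      avg t + (t - t) * \<phi> t * measure M (space M)) (at_right t)"
    using density assms by (intro tendsto_intros) (auto simp: young_density_def)
  then show "((\<lambda>u. avg t + (u - t) * \<phi> u * measure M (space M)) \<longlongrightarrow> avg t) (at_right t)"
    by simp
qed simp

text \<open>Monotonicity is that of \<open>\<Phi> t / t\<close>. At \<open>0\<close> the density is squeezed by
  \<open>avg u / u \<le> \<mu>(M) * \<Phi> u / u \<le> \<mu>(M) * \<phi> u\<close>, where \<open>\<mu>(M)\<close> is the total mass, and it diverges at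
  infinity because \<open>avg u / u\<close> is at least a multiple of \<open>\<Phi> (u / 2) / u\<close>, hence of
  \<open>\<phi> (u / 4)\<close>.\<close>

lemma young_density_avg_density: "young_density avg_density"
  unfolding young_density_def
proof (intro conjI allI impI)
  show "avg_density 0 = 0" by (simp add: avg_density_def)
  show "0 < avg_density t" if "0 < t" for t
  proof -
    have "0 < measure M {w \<in> space M. 1 / 2 \<le> a w} * \<Phi> (t / 2)"
      using that by (intro mult_pos_pos a_large young_pos[OF young]) auto
    then show ?thesis using avg_ge[of t] that by (simp add: avg_density_def)
  qed
  show "mono_on {0..} avg_density"
    using avg_density_mono by (auto simp: mono_on_def mono_def)
  show "(avg_density \<longlongrightarrow> avg_density t) (at_right t)" if "0 \<le> t" for t
  proof (cases "t = 0")
    case True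
    show ?thesis
    proof (rule tendsto_sandwich)
      show "\<forall>\<^sub>F u in at_right t. 0 \<le> avg_density u"
        by (simp add: avg_density_nonneg)
      have "avg_density u \<le> measure M (space M) * \<phi> u" if "0 < u" for u
      proof -
        have "avg u \<le> measure M (space M) * (u * \<phi> u)"
          using avg_le[of u] young_le_density[OF young, of u] that
          by (meson less_imp_le measure_nonneg mult_left_mono order_trans)
        then show ?thesis using that by (simp add: avg_density_def field_simps)
      qed
      then show "\<forall>\<^sub>F u in at_right t. avg_density u \<le> measure M (space M) * \<phi> u"
        using True by (auto simp: eventually_at_filter intro!: always_eventually)
      have "((\<lambda>u. measure M (space M) * \<phi> u) \<longlongrightarrow> measure M (space M) * \<phi> 0) (at_right 0)"
        using density by (intro tendsto_intros) (auto simp: young_density_def)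
      then show "((\<lambda>u. measure M (space M) * \<phi> u) \<longlongrightarrow> avg_density t) (at_right t)"
        using density True by (simp add: young_density_def avg_density_def)
    qed (simp add: True avg_density_def)
  next
    case False
    have "((\<lambda>u. avg u / u) \<longlongrightarrow> avg t / t) (at_right t)"
      using False that by (intro tendsto_intros avg_right_continuous) auto
    moreover have "\<forall>\<^sub>F u in at_right t. avg u / u = avg_density u"
      using that by (auto simp: eventually_at_filter avg_density_def intro!: always_eventually)
    ultimately show ?thesis
      using False that by (subst (asm) tendsto_cong) (auto simp: avg_density_def)
  qed
  show "filterlim avg_density at_top at_top"
  proof (rule filterlim_at_top_mono)
    define m where "m = measure M {w \<in> space M. 1 / 2 \<le> a w}"
    have "0 < m" using a_large by (simp add: m_def)
    have "filterlim (\<lambda>u :: real. 1 / 4 * u) at_top at_top"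
      by (rule filterlim_tendsto_pos_mult_at_top[OF tendsto_const _ filterlim_ident]) simp
    then have "filterlim (\<lambda>u. \<phi> (1 / 4 * u)) at_top at_top"
      using density by (auto simp: young_density_def intro: filterlim_compose)
    then show "filterlim (\<lambda>u. m / 4 * \<phi> (1 / 4 * u)) at_top at_top"
      using \<open>0 < m\<close> by (intro filterlim_tendsto_pos_mult_at_top[OF tendsto_const]) auto
    show "\<forall>\<^sub>F u in at_top. m / 4 * \<phi> (1 / 4 * u) \<le> avg_density u"
      using eventually_gt_at_top[of 0]
    proof eventually_elim
      case (elim u)
      have "m * (u / 4 * \<phi> (u / 4)) \<le> m * \<Phi> (u / 2)"
        using young_half_ge_density[OF young, of "u / 2"] elim \<open>0 < m\<close> by (intro mult_left_mono) auto
      also have "\<dots> \<le> avg u" using avg_ge[of u] elim by (simp add: m_def)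
      finally show ?case using elim by (simp add: avg_density_def field_simps)
    qed
  qed
qed

lemma nn_integral_avg:
  assumes "0 \<le> t"
  shows "(\<integral>\<^sup>+ r\<in>{0<..<1}. (\<integral>\<^sup>+ w. ennreal (\<Phi> (t * a w * r)) \<partial>M) * ennreal (1 / r) \<partial>lborel)
           = ennreal (LBINT \<tau>:{0..t}. avg_density \<tau>)"
proof (cases "t = 0")
  case True
  have "(LBINT \<tau>:{0..0}. avg_density \<tau>) = 0"
    by (rule set_integral_degenerate_interval) (simp add: avg_density_def)
  then show ?thesis using True by (simp add: young_zero[OF young])
next
  case False
  then have "0 < t" using assms by simp
  have [measurable]: "avg_density \<in> borel_measurable borel"
    by (rule borel_measurable_mono[OF avg_density_mono])
  have "(\<integral>\<^sup>+ r\<in>{0<..<1}. (\<integral>\<^sup>+ w. ennreal (\<Phi> (t * a w * r)) \<partial>M) * ennreal (1 / r) \<partial>lborel)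
      = (\<integral>\<^sup>+ r. ennreal t * ennreal (indicator {0<..<t} (0 + t * r) * avg_density (0 + t * r)) \<partial>lborel)"
  proof (rule nn_integral_cong)
    fix r :: real
    show "(\<integral>\<^sup>+ w. ennreal (\<Phi> (t * a w * r)) \<partial>M) * ennreal (1 / r) * indicator {0<..<1} r
        = ennreal t * ennreal (indicator {0<..<t} (0 + t * r) * avg_density (0 + t * r))"
    proof (cases "0 < r \<and> r < 1")
      case True
      then have tr: "0 < t * r" "t * r < t" using \<open>0 < t\<close> by auto
      have "(\<integral>\<^sup>+ w. ennreal (\<Phi> (t * a w * r)) \<partial>M) = (\<integral>\<^sup>+ w. ennreal (\<Phi> (t * r * a w)) \<partial>M)"
        by (simp add: ac_simps)
      also have "\<dots> = ennreal (avg (t * r))"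
        unfolding avg_def using tr scaled_range
        by (intro nn_integral_eq_integral integrable_scaled AE_I2 young_nonneg[OF young]) auto
      finally have "(\<integral>\<^sup>+ w. ennreal (\<Phi> (t * a w * r)) \<partial>M) * ennreal (1 / r) = ennreal (avg (t * r) * (1 / r))"
        using True avg_nonneg[of "t * r"] tr by (subst ennreal_mult) auto
      also have "avg (t * r) * (1 / r) = t * avg_density (t * r)"
      proof -
        have "avg_density (t * r) = avg (t * r) / (t * r)"
          using tr(1) by (metis avg_density_def leD)
        then show ?thesis using \<open>0 < t\<close> by simp
      qed
      also have "ennreal \<dots> = ennreal t * ennreal (avg_density (t * r))"
        using \<open>0 < t\<close> avg_density_nonneg by (intro ennreal_mult) auto
      finally show ?thesis using True tr by simp
    next
      case False
      then have "t * r \<notin> {0<..<t}" using \<open>0 < t\<close> by (auto simp: zero_less_mult_iff)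
      then show ?thesis using False by auto
    qed
  qed
  also have "\<dots> = ennreal \<bar>t\<bar> * (\<integral>\<^sup>+ r. ennreal (indicator {0<..<t} (0 + t * r) * avg_density (0 + t * r)) \<partial>lborel)"
    using \<open>0 < t\<close> by (subst nn_integral_cmult) auto
  also have "\<dots> = (\<integral>\<^sup>+ \<tau>. ennreal (indicator {0<..<t} \<tau> * avg_density \<tau>) \<partial>lborel)"
    using \<open>0 < t\<close> by (intro nn_integral_real_affine[symmetric]) auto
  also have "\<dots> = (\<integral>\<^sup>+ \<tau>. ennreal (indicator {0..t} \<tau> *\<^sub>R avg_density \<tau>) \<partial>lborel)"
    by (rule nn_integral_cong_AE, rule eventually_mono[OF AE_lborel_singleton[of t]])
       (auto simp: indicator_def avg_density_def)
  also have "\<dots> = ennreal (LBINT \<tau>:{0..t}. avg_density \<tau>)"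
    unfolding set_lebesgue_integral_def
    using young_density_set_integrable[OF young_density_avg_density, of 0 "{0..t}" t] avg_density_nonneg
    by (intro nn_integral_eq_integral) (auto simp: set_integrable_def)
  finally show ?thesis .
qed

text \<open>Both bounds are instances of \<open>t / 2 * h (t / 2) \<le> H t \<le> t * h t\<close> for a monotone density \<open>h\<close>
  of \<open>H\<close>; here \<open>t * h t\<close> is the average itself.\<close>

lemma avg_primitive_bounds:
  assumes "young_with_density avg_density H" and "0 \<le> t"
  shows "measure M {w \<in> space M. 1 / 2 \<le> a w} * \<Phi> (t / 4) \<le> H t"
    and "H t \<le> measure M (space M) * \<Phi> t"
proof -
  have avg: "u * avg_density u = avg u" if "0 \<le> u" for u
    using that avg_le[of 0] avg_nonneg[of 0] by (cases "u = 0") (auto simp: avg_density_def young_zero[OF young])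
  have "measure M {w \<in> space M. 1 / 2 \<le> a w} * \<Phi> (t / 2 / 2) \<le> avg (t / 2)"
    using assms(2) by (intro avg_ge) simp
  also have "\<dots> \<le> H t"
    using young_half_ge_density[OF assms] avg[of "t / 2"] assms(2) by simp
  finally show "measure M {w \<in> space M. 1 / 2 \<le> a w} * \<Phi> (t / 4) \<le> H t" by simp
  show "H t \<le> measure M (space M) * \<Phi> t"
    using young_le_density[OF assms] avg[OF assms(2)] avg_le[OF assms(2)] by simp
qed

end

section \<open>Comparison of the averaged function with the diagonal\<close>

theorem proposition3p2:
  fixes g G :: "real^'n \<Rightarrow> real^'n \<Rightarrow> real \<Rightarrow> real" and k :: 'n
  assumes "gen_young2 g G" and "cond_H1 G" and "cond_H2 G" and "cond_H3 g G"
  shows "(\<forall>x. \<forall>t\<ge>0. H0_ext k G x t < \<infinity>) \<and>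
         gen_young1 (H0 k G) \<and>
         (\<exists>c1 c2. c1 > 0 \<and> c2 > 0 \<and>
            (\<forall>x. \<forall>t\<ge>0. c1 * diag G x t \<le> H0 k G x t \<and> H0 k G x t \<le> c2 * diag G x t))"
proof -
  let ?\<sigma> = "sphere_measure :: (real^'n) measure"
  have wy: "weighted_young ?\<sigma> (\<lambda>w. \<bar>w $ k\<bar>) (g x x) (G x x)" for x
  proof (intro weighted_young.intro finite_measure_sphere_measure weighted_young_axioms.intro)
    show "(\<lambda>w. \<bar>w $ k\<bar>) \<in> borel_measurable ?\<sigma>"
      by (intro borel_measurable_sphere_measure borel_measurable_continuous_onI continuous_intros)
    show "0 \<le> \<bar>w $ k\<bar> \<and> \<bar>w $ k\<bar> \<le> 1" if "w \<in> space ?\<sigma>" for w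
      using that component_le_norm_cart[of w k] by simp
    show "young_with_density (g x x) (G x x)"
      using assms(1) by (simp add: gen_young2_def)
  qed (rule sphere_measure_caps_pos)
  define h where "h x = weighted_young.avg_density ?\<sigma> (\<lambda>w. \<bar>w $ k\<bar>) (G x x)" for x
  have ext: "H0_ext k G x t = ennreal (LBINT \<tau>:{0..t}. h x \<tau>)" if "0 \<le> t" for x t
    unfolding H0_ext_def h_def by (rule weighted_young.nn_integral_avg[OF wy that])
  have young: "young_with_density (h x) (H0 k G x)" for x
    unfolding young_with_density_def
  proof (intro conjI allI impI)
    show "young_density (h x)"
      unfolding h_def by (rule weighted_young.young_density_avg_density[OF wy])
    fix t :: real assume "0 \<le> t"
    have "0 \<le> (LBINT \<tau>:{0..t}. h x \<tau>)"
      unfolding set_lebesgue_integral_def h_def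
      by (intro Bochner_Integration.integral_nonneg) (simp add: weighted_young.avg_density_nonneg[OF wy])
    then show "H0 k G x t = (LBINT \<tau>:{0..t}. h x \<tau>)"
      by (simp add: H0_def ext[OF \<open>0 \<le> t\<close>])
  qed
  obtain p where p: "\<And>x t. 0 < t \<Longrightarrow> t * g x x t / G x x t \<le> p"
    using assms(4) by (auto simp: cond_H3_def)
  obtain c where "0 < c" and c: "\<And>x t. 0 \<le> t \<Longrightarrow> c * G x x t \<le> G x x (t / 4)"
  proof (rule young_quarter_ge[of p])
    fix c assume "0 < c" and
      "\<And>\<phi> \<Phi> t. young_with_density \<phi> \<Phi> \<Longrightarrow> (\<And>t. 0 < t \<Longrightarrow> t * \<phi> t / \<Phi> t \<le> p) \<Longrightarrow> 0 \<le> t \<Longrightarrow> c * \<Phi> t \<le> \<Phi> (t / 4)"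
    then show thesis
      using that[of c] p weighted_young.young[OF wy] by blast
  qed
  define m where "m = measure ?\<sigma> {w \<in> space ?\<sigma>. 1 / 2 \<le> \<bar>w $ k\<bar>}"
  have "0 < m" unfolding m_def by (rule sphere_measure_caps_pos)
  have "m \<le> measure ?\<sigma> (space ?\<sigma>)"
    unfolding m_def by (rule finite_measure.bounded_measure[OF finite_measure_sphere_measure])
  have bounds: "m * c * diag G x t \<le> H0 k G x t \<and> H0 k G x t \<le> measure ?\<sigma> (space ?\<sigma>) * diag G x t"
    if "0 \<le> t" for x t
  proof
    have "m * (c * G x x t) \<le> m * G x x (t / 4)"
      using \<open>0 < m\<close> c[OF that] by (intro mult_left_mono) auto
    also have "\<dots> \<le> H0 k G x t"
      unfolding m_def by (rule weighted_young.avg_primitive_bounds(1)[OF wy young[unfolded h_def] that])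
    finally show "m * c * diag G x t \<le> H0 k G x t" by (simp add: diag_def)
    show "H0 k G x t \<le> measure ?\<sigma> (space ?\<sigma>) * diag G x t"
      unfolding diag_def by (rule weighted_young.avg_primitive_bounds(2)[OF wy young[unfolded h_def] that])
  qed
  show ?thesis
  proof (intro conjI)
    show "\<forall>x. \<forall>t\<ge>0. H0_ext k G x t < \<infinity>" by (simp add: ext)
    show "gen_young1 (H0 k G)" using young by (auto simp: gen_young1_def)
    show "\<exists>c1 c2. c1 > 0 \<and> c2 > 0 \<and>
            (\<forall>x. \<forall>t\<ge>0. c1 * diag G x t \<le> H0 k G x t \<and> H0 k G x t \<le> c2 * diag G x t)"
      using bounds \<open>0 < m\<close> \<open>0 < c\<close> \<open>m \<le> measure ?\<sigma> (space ?\<sigma>)\<close>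
      by (intro exI[of _ "m * c"] exI[of _ "measure ?\<sigma> (space ?\<sigma>)"]) auto
  qed
qed

end
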